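(* The axiomatization consisting of A1-4, T1$'$, T2 and WE is sound and ground-complete for BCCS($A$) modulo $\precsim_{\rm WT}$. If $|A|>1$, this axiomatization is also $\omega$-complete.
   Context: $A$ is a nonempty countable set of actions, $\tau\notin A$, $A_\tau=A\cup\{\tau\}$. BCCS($A$) terms: $t::=0\mid x\mid\alpha t\mid t+t$ ($x$ a variable, $\alpha\in A_\tau$). Transitions: $\alpha t\xrightarrow{\alpha}t$; if $t\xrightarrow{\alpha}t'$ then $t+u\xrightarrow{\alpha}t'$ and $u+t\xrightarrow{\alpha}t'$. $\Rightarrow$ is the reflexive-transitive closure of $\xrightarrow{\tau}$. $a_1\cdots a_k\in A^*$ is a weak trace of closed $s$ if $s\Rightarrow\xrightarrow{a_1}\Rightarrow\cdots\xrightarrow{a_k}\Rightarrow s'$; $\mathcal{WT}(s)$ the set. $s_1\precsim_{\rm WT}s_2$ iff $\mathcal{WT}(s_1)\subseteq\mathcal{WT}(s_2)$; on open terms via all closed substitutions. Inequational logic (reflexivity, transitivity, substitution instances, closure under contexts; an equation abbreviates two inequations); sound, ground-complete, $\omega$-complete (if all closed instances derivable then the inequation is). Axioms ($\alpha\in A_\tau$): A1: $x+y\approx y+x$; A2: $(x+y)+z\approx x+(y+z)$; A3: $x+x\approx x$; A4: $x+0\approx x$; T1$'$: $\alpha(x+y)\preccurlyeq\alpha x+\alpha y$; T2: $x\preccurlyeq x+y$; WE: $x\approx\tau x$. *)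

theory Defs
  imports Main "HOL-Library.Countable"
begin

text \<open>
  The action set $A$ is the universe of a type \<open>'a\<close> (of class \<open>countable\<close> in the theorem);
  \<open>'a act\<close> is $A_\tau$. The variables are the natural numbers, a fixed countably infinite set.
\<close>

datatype 'a act = Tau | Act 'a

datatype 'a bccs =
    Null                         (\<open>\<zero>\<close>)
  | Var nat
  | Pre "'a act" "'a bccs"
  | Plus "'a bccs" "'a bccs"     (infixl \<open>\<oplus>\<close> 65)

primrec vars :: "'a bccs \<Rightarrow> nat set" where
  "vars \<zero> = {}"
| "vars (Var x) = {x}"
| "vars (Pre \<alpha> t) = vars t"
| "vars (t \<oplus> u) = vars t \<union> vars u"

definition closed_term :: "'a bccs \<Rightarrow> bool" where
  "closed_term t \<longleftrightarrow> vars t = {}"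

primrec subst :: "(nat \<Rightarrow> 'a bccs) \<Rightarrow> 'a bccs \<Rightarrow> 'a bccs" where
  "subst \<sigma> \<zero> = \<zero>"
| "subst \<sigma> (Var x) = \<sigma> x"
| "subst \<sigma> (Pre \<alpha> t) = Pre \<alpha> (subst \<sigma> t)"
| "subst \<sigma> (t \<oplus> u) = subst \<sigma> t \<oplus> subst \<sigma> u"

definition closed_subst :: "(nat \<Rightarrow> 'a bccs) \<Rightarrow> bool" where
  "closed_subst \<sigma> \<longleftrightarrow> (\<forall>x. closed_term (\<sigma> x))"

inductive step :: "'a act \<Rightarrow> 'a bccs \<Rightarrow> 'a bccs \<Rightarrow> bool" where
  step_pre: "step \<alpha> (Pre \<alpha> t) t"
| step_plus1: "step \<alpha> t t' \<Longrightarrow> step \<alpha> (t \<oplus> u) t'"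
| step_plus2: "step \<alpha> t t' \<Longrightarrow> step \<alpha> (u \<oplus> t) t'"

abbreviation taus :: "'a bccs \<Rightarrow> 'a bccs \<Rightarrow> bool" where
  "taus \<equiv> (step Tau)\<^sup>*\<^sup>*"

primrec weak_steps :: "'a list \<Rightarrow> 'a bccs \<Rightarrow> 'a bccs \<Rightarrow> bool" where
  "weak_steps [] s s' \<longleftrightarrow> taus s s'"
| "weak_steps (a # w) s s' \<longleftrightarrow>
     (\<exists>s1 s2. taus s s1 \<and> step (Act a) s1 s2 \<and> weak_steps w s2 s')"

definition WT :: "'a bccs \<Rightarrow> 'a list set" where
  "WT s = {w. \<exists>s'. weak_steps w s s'}"

text \<open>
  \<open>wt_le\<close> is only meaningful on closed terms; \<open>lift_open\<close> extends a preorder on closed terms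
  to open terms.
\<close>

definition wt_le :: "'a bccs \<Rightarrow> 'a bccs \<Rightarrow> bool" where
  "wt_le s1 s2 \<longleftrightarrow> WT s1 \<subseteq> WT s2"

definition lift_open :: "('a bccs \<Rightarrow> 'a bccs \<Rightarrow> bool) \<Rightarrow> 'a bccs \<Rightarrow> 'a bccs \<Rightarrow> bool" where
  "lift_open R t u \<longleftrightarrow> (\<forall>\<sigma>. closed_subst \<sigma> \<longrightarrow> R (subst \<sigma> t) (subst \<sigma> u))"

text \<open>An axiomatization is a set of inequations, \<open>(t, u)\<close> standing for $t \preccurlyeq u$.\<close>

inductive derivable :: "('a bccs \<times> 'a bccs) set \<Rightarrow> 'a bccs \<Rightarrow> 'a bccs \<Rightarrow> bool"
  for E :: "('a bccs \<times> 'a bccs) set" where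
  der_ax: "(t, u) \<in> E \<Longrightarrow> derivable E t u"
| der_refl: "derivable E t t"
| der_trans: "derivable E t u \<Longrightarrow> derivable E u v \<Longrightarrow> derivable E t v"
| der_subst: "derivable E t u \<Longrightarrow> derivable E (subst \<sigma> t) (subst \<sigma> u)"
| der_pre: "derivable E t u \<Longrightarrow> derivable E (Pre \<alpha> t) (Pre \<alpha> u)"
| der_plus1: "derivable E t u \<Longrightarrow> derivable E (t \<oplus> v) (u \<oplus> v)"
| der_plus2: "derivable E t u \<Longrightarrow> derivable E (v \<oplus> t) (v \<oplus> u)"

definition sound :: "('a bccs \<times> 'a bccs) set \<Rightarrow> ('a bccs \<Rightarrow> 'a bccs \<Rightarrow> bool) \<Rightarrow> bool" where
  "sound E R \<longleftrightarrow> (\<forall>t u. derivable E t u \<longrightarrow> lift_open R t u)"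

definition ground_complete ::
    "('a bccs \<times> 'a bccs) set \<Rightarrow> ('a bccs \<Rightarrow> 'a bccs \<Rightarrow> bool) \<Rightarrow> bool" where
  "ground_complete E R \<longleftrightarrow>
     (\<forall>p q. closed_term p \<longrightarrow> closed_term q \<longrightarrow> R p q \<longrightarrow> derivable E p q)"

definition omega_complete :: "('a bccs \<times> 'a bccs) set \<Rightarrow> bool" where
  "omega_complete E \<longleftrightarrow>
     (\<forall>t u. (\<forall>\<sigma>. closed_subst \<sigma> \<longrightarrow> derivable E (subst \<sigma> t) (subst \<sigma> u)) \<longrightarrow> derivable E t u)"

definition equation :: "'a bccs \<Rightarrow> 'a bccs \<Rightarrow> ('a bccs \<times> 'a bccs) set" where
  "equation t u = {(t, u), (u, t)}"

abbreviation (input) "vx \<equiv> Var 0"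
abbreviation (input) "vy \<equiv> Var 1"
abbreviation (input) "vz \<equiv> Var 2"

definition A1 :: "('a bccs \<times> 'a bccs) set" where
  "A1 = equation (vx \<oplus> vy) (vy \<oplus> vx)"

definition A2 :: "('a bccs \<times> 'a bccs) set" where
  "A2 = equation ((vx \<oplus> vy) \<oplus> vz) (vx \<oplus> (vy \<oplus> vz))"

definition A3 :: "('a bccs \<times> 'a bccs) set" where
  "A3 = equation (vx \<oplus> vx) vx"

definition A4 :: "('a bccs \<times> 'a bccs) set" where
  "A4 = equation (vx \<oplus> \<zero>) vx"

definition T1' :: "('a bccs \<times> 'a bccs) set" where
  "T1' = (\<Union>\<alpha>. {(Pre \<alpha> (vx \<oplus> vy), Pre \<alpha> vx \<oplus> Pre \<alpha> vy)})"

definition T2 :: "('a bccs \<times> 'a bccs) set" where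
  "T2 = {(vx, vx \<oplus> vy)}"

definition WE :: "('a bccs \<times> 'a bccs) set" where
  "WE = equation vx (Pre Tau vx)"

definition WT_axioms :: "('a bccs \<times> 'a bccs) set" where
  "WT_axioms = A1 \<union> A2 \<union> A3 \<union> A4 \<union> T1' \<union> T2 \<union> WE"

end

theory Submission imports Defs begin

text \<open>
  To an open term \<open>t\<close> assign the set of pairs \<open>(w, e)\<close> where \<open>w\<close> is a weak trace of \<open>t\<close> and \<open>e\<close> is
  either \<open>None\<close> or a variable \<open>Some x\<close> enabled at the end of \<open>w\<close>. By T1$'$ and WE every term lies
  below any upper bound of its linear paths, and by T2 each path lies below the term; hence
  \<open>t \<preceq> u\<close> is derivable iff the paths of \<open>t\<close> are among those of \<open>u\<close>. On closed terms the paths are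
  the weak traces. For $\omega$-completeness, a path of \<open>t\<close> ending in \<open>x\<close> is detected by substituting
  $a^n b$ for \<open>x\<close>, with \<open>a \<noteq> b\<close> and \<open>n\<close> exceeding the depth of \<open>u\<close>, and \<open>\<zero>\<close> for all other variables.
\<close>

section \<open>Weak paths of open terms\<close>

primrec weak_paths :: "'a bccs \<Rightarrow> ('a list \<times> nat option) set" where
  "weak_paths \<zero> = {([], None)}"
| "weak_paths (Var x) = {([], None), ([], Some x)}"
| "weak_paths (Pre \<alpha> t) = (case \<alpha> of Tau \<Rightarrow> weak_paths t
     | Act a \<Rightarrow> insert ([], None) {(a # w, e) | w e. (w, e) \<in> weak_paths t})"
| "weak_paths (t \<oplus> u) = weak_paths t \<union> weak_paths u"

lemma Nil_weak_paths [simp]: "([], None) \<in> weak_paths t"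
  by (induction t) (auto split: act.split)

lemma weak_paths_drop_var: "(w, e) \<in> weak_paths t \<Longrightarrow> (w, None) \<in> weak_paths t"
  by (induction t arbitrary: w) (auto split: act.splits)

lemma weak_paths_length: "(w, e) \<in> weak_paths t \<Longrightarrow> length w \<le> size t"
proof (induction t arbitrary: w)
  case (Pre \<alpha> t)
  then show ?case by (cases \<alpha>) (auto intro: le_SucI)
next
  case (Plus t u)
  then show ?case by (auto simp: trans_le_add1 trans_le_add2 le_SucI)
qed auto

lemma weak_paths_closed: "closed_term t \<Longrightarrow> (w, e) \<in> weak_paths t \<Longrightarrow> e = None"
  by (induction t arbitrary: w) (auto simp: closed_term_def split: act.splits)

text \<open>A variable is replaced where a path ends, so a path of the instance either stays inside
  \<open>t\<close>, and then has end \<open>None\<close>, or reaches some \<open>x\<close> and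
  continues inside \<open>\<sigma> x\<close>.\<close>

lemma weak_paths_subst:
  "(w, e) \<in> weak_paths (subst \<sigma> t) \<longleftrightarrow>
     e = None \<and> (w, None) \<in> weak_paths t
     \<or> (\<exists>v x v'. (v, Some x) \<in> weak_paths t \<and> w = v @ v' \<and> (v', e) \<in> weak_paths (\<sigma> x))"
proof (induction t arbitrary: w)
  case (Pre \<alpha> t)
  show ?case
  proof (cases \<alpha>)
    case Tau
    then show ?thesis using Pre.IH[of w] by simp
  next
    case (Act a)
    show ?thesis
    proof (cases w)
      case Nil
      then show ?thesis using Act by auto
    next
      case (Cons b w')
      then show ?thesis using Act Pre.IH[of w'] by (auto simp: Cons_eq_append_conv)
    qed
  qed
next
  case (Plus t u)
  then show ?case by (simp, blast)
qed auto

section \<open>Weak traces as the paths with end \<open>None\<close>\<close>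

lemma step_Tau_weak_paths: "step Tau t t' \<Longrightarrow> weak_paths t' \<subseteq> weak_paths t"
  by (induction "Tau :: 'a act" t t' rule: step.induct) auto

lemma step_Act_weak_paths:
  "step (Act a) t t' \<Longrightarrow> (w, e) \<in> weak_paths t' \<Longrightarrow> (a # w, e) \<in> weak_paths t"
  by (induction "Act a" t t' rule: step.induct) auto

lemma taus_weak_paths: "taus t t' \<Longrightarrow> weak_paths t' \<subseteq> weak_paths t"
  by (induction rule: rtranclp_induct) (use step_Tau_weak_paths in blast)+

lemma weak_steps_weak_paths: "weak_steps w t t' \<Longrightarrow> (w, None) \<in> weak_paths t"
proof (induction w arbitrary: t)
  case (Cons a w)
  then show ?case by simp (meson step_Act_weak_paths subsetD taus_weak_paths)
qed simp

lemma Nil_WT: "[] \<in> WT t"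
  by (auto simp: WT_def)

lemma WT_I: "weak_steps w t t' \<Longrightarrow> w \<in> WT t"
  by (auto simp: WT_def)

lemma Cons_WT:
  "a # w \<in> WT t \<longleftrightarrow> (\<exists>t1 t2. taus t t1 \<and> step (Act a) t1 t2 \<and> w \<in> WT t2)"
proof
  assume "a # w \<in> WT t"
  then obtain t' where "weak_steps (a # w) t t'" by (auto simp only: WT_def)
  then show "\<exists>t1 t2. taus t t1 \<and> step (Act a) t1 t2 \<and> w \<in> WT t2"
    by (auto intro: WT_I)
next
  assume "\<exists>t1 t2. taus t t1 \<and> step (Act a) t1 t2 \<and> w \<in> WT t2"
  then obtain t1 t2 t' where "taus t t1" "step (Act a) t1 t2" "weak_steps w t2 t'"
    by (auto simp: WT_def)
  then show "a # w \<in> WT t" by (intro WT_I[of _ _ t']) auto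
qed

text \<open>Only the first transition of a run leaves the start term, so copying initial transitions
  is enough. This handles sums: \<open>t \<oplus> u\<close> has in general no silent move to
  \<open>t\<close>.\<close>

lemma WT_mono_steps:
  assumes "\<And>\<alpha> t'. step \<alpha> t t' \<Longrightarrow> step \<alpha> u t'"
  shows "WT t \<subseteq> WT u"
proof
  fix w assume w: "w \<in> WT t"
  show "w \<in> WT u"
  proof (cases w)
    case Nil
    then show ?thesis by (simp add: Nil_WT)
  next
    case (Cons a w')
    then obtain s1 s2 where s: "taus t s1" "step (Act a) s1 s2" "w' \<in> WT s2"
      using w by (auto simp: Cons_WT)
    \<comment> \<open>If the silent run is empty, the visible step is the initial one; otherwise its
      first tau-step is.\<close>
    from s(1) have "\<exists>s1'. taus u s1' \<and> step (Act a) s1' s2"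
    proof (cases rule: converse_rtranclpE)
      case base
      then show ?thesis using s(2) assms by blast
    next
      case (step y)
      then show ?thesis using s(2) assms by (meson converse_rtranclp_into_rtranclp)
    qed
    then show ?thesis using Cons s(3) by (auto simp: Cons_WT)
  qed
qed

lemma weak_paths_WT: "(w, None) \<in> weak_paths t \<Longrightarrow> w \<in> WT t"
proof (induction t arbitrary: w)
  case (Pre \<alpha> t)
  show ?case
  proof (cases \<alpha>)
    case Tau
    then have "w \<in> WT t" using Pre by simp
    moreover have "step Tau (Pre \<alpha> t) t" using Tau by (simp add: step_pre)
    ultimately show ?thesis
      by (cases w) (auto simp: Nil_WT Cons_WT intro: converse_rtranclp_into_rtranclp)
  next
    case (Act a)
    with Pre.prems consider "w = []" | w' where "w = a # w'" "(w', None) \<in> weak_paths t"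
      by auto
    then show ?thesis
    proof cases
      case 2
      then show ?thesis using Pre.IH[of w'] Act step_pre by (fastforce simp: Cons_WT)
    qed (simp add: Nil_WT)
  qed
next
  case (Plus t u)
  have "WT t \<subseteq> WT (t \<oplus> u)" by (intro WT_mono_steps step_plus1)
  moreover have "WT u \<subseteq> WT (t \<oplus> u)" by (intro WT_mono_steps step_plus2)
  ultimately show ?case using Plus by auto
qed (auto simp: Nil_WT)

lemma WT_iff_weak_paths: "w \<in> WT t \<longleftrightarrow> (w, None) \<in> weak_paths t"
  using weak_paths_WT weak_steps_weak_paths by (auto simp: WT_def)

section \<open>The derivable preorder and its basic laws\<close>

abbreviation wt_derivable :: "'a bccs \<Rightarrow> 'a bccs \<Rightarrow> bool" (infix \<open>\<preceq>\<close> 50) where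
  "t \<preceq> u \<equiv> derivable WT_axioms t u"

text \<open>Induction on derivations. For the substitution rule, \<open>weak_paths_subst\<close>
  shows that the paths of an instance depend monotonically on those of the term.\<close>

lemma derivable_weak_paths: "t \<preceq> u \<Longrightarrow> weak_paths t \<subseteq> weak_paths u"
proof (induction rule: derivable.induct)
  case (der_ax t u)
  then show ?case
    by (auto simp: WT_axioms_def A1_def A2_def A3_def A4_def T1'_def T2_def WE_def equation_def
        split: act.splits)
next
  case (der_subst t u \<sigma>)
  then show ?case by (intro subrelI) (unfold weak_paths_subst, blast)
next
  case (der_pre t u \<alpha>)
  then show ?case by (auto split: act.split)
qed auto

lemma axiom_instance:
  "(t, u) \<in> WT_axioms \<Longrightarrow> subst (\<lambda>n. if n = 0 then x else y) t \<preceq> subst (\<lambda>n. if n = 0 then x else y) u"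
  by (intro der_subst der_ax)

lemma plus_commute_le: "x \<oplus> y \<preceq> y \<oplus> x"
  using axiom_instance[of "vx \<oplus> vy" "vy \<oplus> vx" x y]
  by (simp add: WT_axioms_def A1_def equation_def)

lemma plus_idem_le: "x \<oplus> x \<preceq> x"
  using axiom_instance[of "vx \<oplus> vx" vx x x]
  by (simp add: WT_axioms_def A3_def equation_def)

lemma plus_Null_le: "x \<oplus> \<zero> \<preceq> x"
  using axiom_instance[of "vx \<oplus> \<zero>" vx x x]
  by (simp add: WT_axioms_def A4_def equation_def)

lemma Pre_plus_le: "Pre \<alpha> (x \<oplus> y) \<preceq> Pre \<alpha> x \<oplus> Pre \<alpha> y"
  using axiom_instance[of "Pre \<alpha> (vx \<oplus> vy)" "Pre \<alpha> vx \<oplus> Pre \<alpha> vy" x y]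
  by (simp add: WT_axioms_def T1'_def)

lemma le_plus1: "x \<preceq> x \<oplus> y"
  using axiom_instance[of vx "vx \<oplus> vy" x y]
  by (simp add: WT_axioms_def T2_def)

lemma le_Tau: "x \<preceq> Pre Tau x"
  using axiom_instance[of vx "Pre Tau vx" x x]
  by (simp add: WT_axioms_def WE_def equation_def)

lemma Tau_le: "Pre Tau x \<preceq> x"
  using axiom_instance[of "Pre Tau vx" vx x x]
  by (simp add: WT_axioms_def WE_def equation_def)

lemma le_plus2: "y \<preceq> x \<oplus> y"
  using le_plus1 plus_commute_le by (rule der_trans)

lemma Null_le: "\<zero> \<preceq> x"
  using le_plus2 plus_Null_le by (rule der_trans)

text \<open>Monotonicity in both arguments and idempotence; with T2 this makes
  \<open>\<oplus>\<close> a join.\<close>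

lemma plus_least: "x \<preceq> z \<Longrightarrow> y \<preceq> z \<Longrightarrow> x \<oplus> y \<preceq> z"
  by (rule der_trans[OF der_plus1 der_trans[OF der_plus2 plus_idem_le]])

section \<open>Linear terms and the characterization of derivability\<close>

definition prefixed :: "'a list \<Rightarrow> 'a bccs \<Rightarrow> 'a bccs" where
  "prefixed w t = foldr (\<lambda>a. Pre (Act a)) w t"

lemma prefixed_simps [simp]:
  "prefixed [] t = t" "prefixed (a # w) t = Pre (Act a) (prefixed w t)"
  "prefixed (v @ w) t = prefixed v (prefixed w t)"
  by (simp_all add: prefixed_def)

text \<open>\<open>None\<close> becomes \<open>\<zero>\<close> because \<open>\<zero>\<close> is
  derivably below every term.\<close>

primrec end_term :: "nat option \<Rightarrow> 'a bccs" where
  "end_term None = \<zero>"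
| "end_term (Some x) = Var x"

lemma prefixed_mono: "t \<preceq> u \<Longrightarrow> prefixed w t \<preceq> prefixed w u"
  by (induction w) (auto intro: der_pre)

lemma prefixed_plus_le: "prefixed w (t \<oplus> u) \<preceq> prefixed w t \<oplus> prefixed w u"
  by (induction w) (auto intro: der_refl der_trans[OF der_pre Pre_plus_le])

lemma weak_path_le: "(w, e) \<in> weak_paths t \<Longrightarrow> prefixed w (end_term e) \<preceq> t"
proof (induction t arbitrary: w)
  case (Pre \<alpha> t)
  show ?case
  proof (cases \<alpha>)
    case Tau
    then show ?thesis using Pre.prems der_trans[OF Pre.IH le_Tau] by simp
  next
    case (Act a)
    with Pre.prems consider "w = []" "e = None" | w' where "w = a # w'" "(w', e) \<in> weak_paths t"
      by auto
    then show ?thesis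
      by cases (simp_all add: Act Null_le der_pre Pre.IH)
  qed
next
  case (Plus t u)
  from Plus.prems show ?case
    by (auto intro: der_trans[OF Plus.IH(1) le_plus1] der_trans[OF Plus.IH(2) le_plus2])
qed (auto intro: der_refl Null_le)

text \<open>T1' splits sums and WE removes tau prefixes until only linear terms remain. The word
  \<open>w\<close> is general because these laws are applied below the letters already read.\<close>

lemma prefixed_le_if_weak_paths_le:
  assumes "\<And>v e. (v, e) \<in> weak_paths t \<Longrightarrow> prefixed (w @ v) (end_term e) \<preceq> u"
  shows "prefixed w t \<preceq> u"
  using assms
proof (induction t arbitrary: w)
  case Null
  then show ?case using Null[of "[]" None] by simp
next
  case (Var x)
  then show ?case using Var[of "[]" "Some x"] by simp
next
  case (Pre \<alpha> t)
  show ?case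
  proof (cases \<alpha>)
    case Tau
    then have "prefixed w t \<preceq> u" using Pre by simp
    then show ?thesis using Tau der_trans prefixed_mono[OF Tau_le] by blast
  next
    case (Act a)
    \<comment> \<open>The visible letter moves into the accumulated prefix.\<close>
    have "prefixed (w @ [a]) t \<preceq> u"
    proof (rule Pre.IH)
      fix v e assume "(v, e) \<in> weak_paths t"
      then show "prefixed ((w @ [a]) @ v) (end_term e) \<preceq> u"
        using Pre.prems[of "a # v" e] Act by simp
    qed
    then show ?thesis using Act by simp
  qed
next
  case (Plus t1 t2)
  have "prefixed w t1 \<preceq> u" by (rule Plus.IH(1)) (rule Plus.prems, simp)
  moreover have "prefixed w t2 \<preceq> u" by (rule Plus.IH(2)) (rule Plus.prems, simp)
  ultimately show ?case by (intro der_trans[OF prefixed_plus_le plus_least])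
qed

lemma derivable_iff_weak_paths: "t \<preceq> u \<longleftrightarrow> weak_paths t \<subseteq> weak_paths u"
proof
  assume sub: "weak_paths t \<subseteq> weak_paths u"
  have "prefixed [] t \<preceq> u"
    by (rule prefixed_le_if_weak_paths_le) (use sub in \<open>auto intro: weak_path_le\<close>)
  then show "t \<preceq> u" by simp
qed (rule derivable_weak_paths)

section \<open>Soundness and ground-completeness\<close>

lemma WT_axioms_sound: "sound WT_axioms wt_le"
  unfolding sound_def lift_open_def wt_le_def
proof (intro allI impI subsetI)
  fix t u :: "'a bccs" and \<sigma> w
  assume "t \<preceq> u" and w: "w \<in> WT (subst \<sigma> t)"
  then have "subst \<sigma> t \<preceq> subst \<sigma> u" by (intro der_subst)
  then show "w \<in> WT (subst \<sigma> u)"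
    using w derivable_weak_paths by (auto simp: WT_iff_weak_paths)
qed

text \<open>All paths of a closed term end in \<open>None\<close> and are thus its weak traces, so
  trace inclusion gives path inclusion.\<close>

lemma WT_axioms_ground_complete: "ground_complete WT_axioms wt_le"
  unfolding ground_complete_def
proof (intro allI impI)
  fix p q :: "'a bccs"
  assume p: "closed_term p" and le: "wt_le p q"
  have "(w, e) \<in> weak_paths q" if "(w, e) \<in> weak_paths p" for w e
    using that le weak_paths_closed[OF p that] by (auto simp: wt_le_def WT_iff_weak_paths)
  then show "p \<preceq> q" by (auto simp: derivable_iff_weak_paths)
qed

section \<open>Omega-completeness\<close>

lemma closed_prefixed_Null: "closed_term (prefixed w \<zero>)"
  by (induction w) (simp_all add: closed_term_def)

lemma weak_paths_prefixed_Null: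
  "(v, e) \<in> weak_paths (prefixed w \<zero>) \<longleftrightarrow> e = None \<and> (\<exists>v'. w = v @ v')"
  by (induction w arbitrary: v) (auto simp: Cons_eq_append_conv)

text \<open>As a nonempty suffix of a word ending in \<open>b\<close>, \<open>v'\<close> ends in
  \<open>b\<close>. As a prefix of a^n b, whose only \<open>b\<close> is its last letter, it must be
  all of a^n b.\<close>

lemma marked_suffix_unique:
  assumes "a \<noteq> b" and "w @ replicate n a @ [b] = v @ v'" and "replicate n a @ [b] = v' @ r" and "v' \<noteq> []"
  shows "v = w"
proof (cases r rule: rev_cases)
  case Nil
  then show ?thesis using assms by simp
next
  case (snoc r' c)
  then have "replicate n a = v' @ r'" using assms(3) by simp
  then have "set v' \<subseteq> {a}"
    by (metis set_append set_replicate_conv_if sup_ge1 empty_subsetI subset_trans)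
  moreover have "last v' = b"
    using assms(2,4) by (metis append_assoc last_appendR last_snoc)
  ultimately show ?thesis using assms(1,4) last_in_set by fastforce
qed

lemma WT_axioms_omega_complete:
  fixes a b :: 'a
  assumes "a \<noteq> b"
  shows "omega_complete (WT_axioms :: ('a bccs \<times> 'a bccs) set)"
  unfolding omega_complete_def
proof (intro allI impI)
  fix t u :: "'a bccs"
  assume all: "\<forall>\<sigma>. closed_subst \<sigma> \<longrightarrow> subst \<sigma> t \<preceq> subst \<sigma> u"
  have "(w, e) \<in> weak_paths u" if we: "(w, e) \<in> weak_paths t" for w e
  proof (cases e)
    case None
    \<comment> \<open>With \<open>\<zero>\<close> for all variables, a path of the instance of
      \<open>u\<close> comes from a path of \<open>u\<close> with the same word, whose end variable
      may be dropped.\<close>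
    have "closed_subst (\<lambda>x. \<zero>)" by (simp add: closed_subst_def closed_term_def)
    with all have "weak_paths (subst (\<lambda>x. \<zero>) t) \<subseteq> weak_paths (subst (\<lambda>x. \<zero>) u)"
      using derivable_weak_paths by blast
    then have "(w, None) \<in> weak_paths (subst (\<lambda>x. \<zero>) u)"
      using we None weak_paths_subst by blast
    then show ?thesis using None by (auto simp: weak_paths_subst dest: weak_paths_drop_var)
  next
    case (Some x)
    \<comment> \<open>Paths of \<open>u\<close> have length at most \<open>size u\<close>, so the
      n+1 letters of \<open>m\<close> force the path \<open>w @ m\<close> of the instance of
      \<open>u\<close> through a variable.\<close>
    define n where "n = size u"
    define m where "m = replicate n a @ [b]"
    define \<sigma> where "\<sigma> = (\<lambda>y. if y = x then prefixed m \<zero> else \<zero>)"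
    have "closed_subst \<sigma>"
      using closed_prefixed_Null by (auto simp: closed_subst_def \<sigma>_def closed_term_def)
    with all have "weak_paths (subst \<sigma> t) \<subseteq> weak_paths (subst \<sigma> u)"
      using derivable_weak_paths by blast
    moreover have "(w @ m, None) \<in> weak_paths (subst \<sigma> t)"
    proof -
      have "(m, None) \<in> weak_paths (\<sigma> x)" by (simp add: \<sigma>_def weak_paths_prefixed_Null)
      then show ?thesis using we Some weak_paths_subst by blast
    qed
    ultimately have "(w @ m, None) \<in> weak_paths (subst \<sigma> u)" by blast
    moreover have short: "(w @ m, e') \<notin> weak_paths u" for e'
      using weak_paths_length[of "w @ m" e' u] by (auto simp: m_def n_def)
    ultimately obtain v y v' where v: "(v, Some y) \<in> weak_paths u" "w @ m = v @ v'"
      "(v', None) \<in> weak_paths (\<sigma> y)"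
      by (auto simp: weak_paths_subst)
    \<comment> \<open>Otherwise \<open>v = w @ m\<close> would be a path of \<open>u\<close>, which
      is too long.\<close>
    have "v' \<noteq> []" using v short by auto
    \<comment> \<open>For \<open>y\<close> other than \<open>x\<close>, \<open>\<sigma> y\<close> is
      \<open>\<zero>\<close>, whose only path is empty.\<close>
    with v(3) have y: "y = x" by (auto simp: \<sigma>_def split: if_splits)
    with v(3) obtain r where "m = v' @ r" by (auto simp: \<sigma>_def weak_paths_prefixed_Null)
    then have "v = w"
      using marked_suffix_unique[OF assms] v(2) \<open>v' \<noteq> []\<close> unfolding m_def by blast
    then show ?thesis using v(1) y Some by simp
  qed
  then show "t \<preceq> u" by (auto simp: derivable_iff_weak_paths)
qed

theorem theorem4p6:
  shows "sound (WT_axioms :: ('a::countable bccs \<times> 'a bccs) set) wt_le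
    \<and> ground_complete (WT_axioms :: ('a bccs \<times> 'a bccs) set) wt_le
    \<and> (infinite (UNIV :: 'a set) \<or> card (UNIV :: 'a set) > 1
         \<longrightarrow> omega_complete (WT_axioms :: ('a bccs \<times> 'a bccs) set))"
proof (intro conjI impI WT_axioms_sound WT_axioms_ground_complete)
  assume "infinite (UNIV :: 'a set) \<or> card (UNIV :: 'a set) > 1"
  \<comment> \<open>\<open>undefined\<close> serves as an arbitrary fixed action; a second one
    exists because the type is not a singleton.\<close>
  then have "\<not> (UNIV :: 'a set) \<subseteq> {undefined}"
    using finite_subset[of "UNIV :: 'a set" "{undefined}"]
      card_mono[of "{undefined}" "UNIV :: 'a set"] by auto
  then obtain b :: 'a where "b \<noteq> undefined" by auto
  then show "omega_complete (WT_axioms :: ('a bccs \<times> 'a bccs) set)"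
    by (rule WT_axioms_omega_complete)
qed

end
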